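(* Let $n\ge1$ and $\tau>0$, and consider the closed-loop dynamic system with input signal $\boldsymbol m:[0,\infty)\to\mathbb R^n$ and outputs $\boldsymbol\theta_{\mathcal D}(t),\boldsymbol\theta_{\mathcal G}(t)\in\mathbb R^n$, obtained by adding the controller $\boldsymbol T_{GS}(s)=\tau$ to the discriminator dynamics: $$\frac{d\boldsymbol\theta_{\mathcal D}}{dt}=\boldsymbol m(t)-\boldsymbol\theta_{\mathcal G}(t)-\tau\,\boldsymbol\theta_{\mathcal D}(t),\qquad \frac{d\boldsymbol\theta_{\mathcal G}}{dt}=\boldsymbol\theta_{\mathcal D}(t).$$ Then the dynamic system of the discriminator is stable: all poles of the transfer function from $\boldsymbol m$ to $\boldsymbol\theta_{\mathcal D}$ have negative real part.
   Context: The system is the gradient flow of a Dirac GAN with perturbed ground truth $p(\boldsymbol r)=\mathrm{Dirac}(\boldsymbol r-\boldsymbol m(t))$, generator distribution $\mathrm{Dirac}(\boldsymbol r-\boldsymbol\theta_{\mathcal G})$ and discriminator $\mathcal D(\boldsymbol r)=\boldsymbol\theta_{\mathcal D}\cdot\boldsymbol r$, to which the feedback term $-\tau\boldsymbol\theta_{\mathcal D}(t)$ (the "GAN stabilizer", a controller with constant transfer function $\tau$) has been added in the discriminator equation. The input $\boldsymbol m$ is assumed to have a Laplace transform $\boldsymbol M(s)$. With zero initial conditions, let $\boldsymbol\Theta_{\mathcal D}(s)$ be the Laplace transform of $\boldsymbol\theta_{\mathcal D}$. The transfer function from $\boldsymbol m$ to $\boldsymbol\theta_{\mathcal D}$ is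 the (scalar, acting componentwise) rational function $T_{\mathcal D}(s)$ with $\boldsymbol\Theta_{\mathcal D}(s)=T_{\mathcal D}(s)\boldsymbol M(s)$. A system is called (asymptotically) stable if all poles of its transfer function have negative real part. *)

theory Defs
  imports "HOL-Complex_Analysis.Complex_Analysis" "HOL-Computational_Algebra.Polynomial"
begin

text \<open>
  The Laplace integral is taken in the Henstock--Kurzweil sense, so on the half-line it covers
  absolutely convergent integrals as well as conditionally convergent improper ones.
\<close>

definition has_laplace :: "(real \<Rightarrow> complex) \<Rightarrow> complex \<Rightarrow> complex \<Rightarrow> bool" where
  "has_laplace f L s \<longleftrightarrow> ((\<lambda>t. exp (- s * of_real t) * f t) has_integral L) {0..}"

definition has_laplace_vec ::
    "(real \<Rightarrow> real ^ 'n) \<Rightarrow> complex ^ 'n \<Rightarrow> complex \<Rightarrow> bool" where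
  "has_laplace_vec f L s \<longleftrightarrow> (\<forall>i. has_laplace (\<lambda>t. of_real (f t $ i)) (L $ i) s)"

text \<open>
  The values of \<open>F\<close> matter only on some right half-plane.
\<close>

definition laplace_transform ::
    "(real \<Rightarrow> real ^ 'n) \<Rightarrow> (complex \<Rightarrow> complex ^ 'n) \<Rightarrow> bool" where
  "laplace_transform f F \<longleftrightarrow> (\<exists>a::real. \<forall>s. Re s > a \<longrightarrow> has_laplace_vec f (F s) s)"

text \<open>
  An input with jumps, such as a step, forces the discriminator parameter to have corners.
  Its equation is therefore required only off a countable set of times, together with continuity;
  continuously differentiable solutions are the special case of an empty exceptional set.
\<close>

definition closed_loop_solution ::
    "real \<Rightarrow> (real \<Rightarrow> real ^ 'n) \<Rightarrow> (real \<Rightarrow> real ^ 'n) \<Rightarrow> (real \<Rightarrow> real ^ 'n) \<Rightarrow> bool" where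
  "closed_loop_solution \<tau> m \<theta>D \<theta>G \<longleftrightarrow>
     continuous_on {0..} \<theta>D \<and>
     (\<exists>S. countable S \<and>
        (\<forall>t\<in>{0..} - S.
           (\<theta>D has_vector_derivative (m t - \<theta>G t - \<tau> *\<^sub>R \<theta>D t)) (at t within {0..}))) \<and>
     (\<forall>t\<in>{0..}. (\<theta>G has_vector_derivative \<theta>D t) (at t within {0..}))"

text \<open>The input-output relation from \<open>m\<close> to \<open>\<theta>D\<close> with zero initial conditions.\<close>

definition discriminator_system ::
    "real \<Rightarrow> (real \<Rightarrow> real ^ 'n) \<Rightarrow> (real \<Rightarrow> real ^ 'n) \<Rightarrow> bool" where
  "discriminator_system \<tau> m \<theta>D \<longleftrightarrow>
     (\<exists>\<theta>G. closed_loop_solution \<tau> m \<theta>D \<theta>G \<and> \<theta>D 0 = 0 \<and> \<theta>G 0 = 0)"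

text \<open>
  At zeros of \<open>q\<close> the quotient takes the junk value 0. This affects neither
  \<^const>\<open>laplace_transform\<close> nor \<^const>\<open>is_pole\<close>, which looks at punctured neighbourhoods only;
  in particular, common zeros of \<open>p\<close> and \<open>q\<close> that cancel are not poles.
\<close>

definition rational_function :: "(complex \<Rightarrow> complex) \<Rightarrow> bool" where
  "rational_function T \<longleftrightarrow> (\<exists>p q. q \<noteq> 0 \<and> T = (\<lambda>s. poly p s / poly q s))"

definition transfer_function ::
    "((real \<Rightarrow> real ^ 'n) \<Rightarrow> (real \<Rightarrow> real ^ 'n) \<Rightarrow> bool) \<Rightarrow> (complex \<Rightarrow> complex) \<Rightarrow> bool" where
  "transfer_function R T \<longleftrightarrow>
     rational_function T \<and>
     (\<forall>u y U. R u y \<longrightarrow> laplace_transform u U \<longrightarrow> laplace_transform y (\<lambda>s. T s *s U s))"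

text \<open>
  The existential conjunct rules out vacuous stability. As functions, two transfer functions of
  the same system may differ at cancelled zeros of the denominators, hence no unique existence.
\<close>

definition stable_system ::
    "((real \<Rightarrow> real ^ 'n) \<Rightarrow> (real \<Rightarrow> real ^ 'n) \<Rightarrow> bool) \<Rightarrow> bool" where
  "stable_system R \<longleftrightarrow>
     (\<exists>T. transfer_function R T) \<and>
     (\<forall>T. transfer_function R T \<longrightarrow> (\<forall>z. is_pole T z \<longrightarrow> Re z < 0))"

end

theory Submission imports Defs begin

text \<open>
  Write \<open>s\<^sup>2 + \<tau> s + 1 = (s - \<nu>)(s - \<mu>)\<close>. With \<open>x = \<theta>G\<close>, \<open>y = \<theta>D\<close> and
  \<open>v = y - \<nu> x\<close> the closed loop becomes the cascade \<open>v' = \<mu> v + m\<close>, \<open>x' = \<nu> x + v\<close> of two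
  first-order equations, also when \<open>\<nu> = \<mu>\<close>; this yields the transfer function
  \<open>s / (s\<^sup>2 + \<tau> s + 1)\<close>. Any other transfer function agrees with it on a right half-plane,
  because some input has a transform without zeros there, hence as a rational function. The roots
  of the denominator have negative real part since \<open>\<tau> > 0\<close>.
\<close>

section \<open>The fundamental theorem of calculus with countably many exceptional points\<close>

text \<open>Sum step functions at the points \<open>s n\<close> with weights
  \<open>(1/2) ^ n\<close>. Each step rises by one weight on arriving at \<open>s n\<close> and by
  another on leaving it, so every nondegenerate interval that contains \<open>s n\<close>, even as
  an endpoint, sees at least one weight. The total height is \<open>2 * 2 = 4\<close>.\<close>

lemma exists_jump_function:
  fixes s :: "nat \<Rightarrow> real"
  obtains \<sigma> :: "real \<Rightarrow> real" where "mono \<sigma>" "\<And>u v. \<sigma> v - \<sigma> u \<le> 4"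
    "\<And>u v n. \<lbrakk>u \<le> s n; s n \<le> v; u < v\<rbrakk> \<Longrightarrow> (1/2) ^ n \<le> \<sigma> v - \<sigma> u"
proof -
  define h :: "real \<Rightarrow> nat \<Rightarrow> real"
    where "h t n = (1/2) ^ n * (of_bool (s n < t) + of_bool (s n \<le> t))" for t n
  define \<sigma> where "\<sigma> t = (\<Sum>n. h t n)" for t
  have bound: "0 \<le> h t n" "h t n \<le> 2 * (1/2) ^ n" for t n
    by (simp_all add: h_def of_bool_def)
  have geom: "(\<lambda>n. 2 * (1/2 :: real) ^ n) sums 4"
    using sums_mult[OF geometric_sums[of "1/2 :: real"], of 2] by simp
  have summ: "summable (h t)" for t
    by (rule summable_comparison_test'[OF sums_summable[OF geom], of 0]) (use bound in auto)
  have le: "h u n \<le> h v n" if "u \<le> v" for u v n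
    using that by (auto simp: h_def of_bool_def)
  show ?thesis
  proof
    show "mono \<sigma>"
      unfolding \<sigma>_def by (intro monoI suminf_le le summ)
  next
    fix u v
    have "\<sigma> v \<le> 4"
      unfolding \<sigma>_def sums_unique[OF geom]
      by (intro suminf_le bound summ sums_summable[OF geom])
    moreover have "0 \<le> \<sigma> u"
      unfolding \<sigma>_def by (intro suminf_nonneg bound summ)
    ultimately show "\<sigma> v - \<sigma> u \<le> 4" by simp
  next
    fix u v n assume *: "u \<le> s n" "s n \<le> v" "u < v"
    have "(1/2) ^ n \<le> h v n - h u n"
      using * by (auto simp: h_def of_bool_def)
    also have "\<dots> = (\<Sum>k\<in>{n}. h v k - h u k)" by simp
    also have "\<dots> \<le> (\<Sum>k. h v k - h u k)"
      using * by (intro sum_le_suminf summable_diff summ) (auto intro: le)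
    also have "\<dots> = \<sigma> v - \<sigma> u"
      unfolding \<sigma>_def by (rule suminf_diff[symmetric]) (rule summ)+
    finally show "(1/2) ^ n \<le> \<sigma> v - \<sigma> u" .
  qed
qed

text \<open>
  The error committed at the \<open>n\<close>-th exceptional point is charged to the increment of an increasing
  function with a jump there, so that all errors telescope along a tagged division.
\<close>

theorem fundamental_theorem_of_calculus_countable:
  fixes f :: "real \<Rightarrow> 'a::banach"
  assumes "a \<le> b" and "countable S" and cont: "continuous_on {a..b} f"
    and deriv: "\<And>x. x \<in> {a..b} - S \<Longrightarrow> (f has_vector_derivative f' x) (at x within {a..b})"
  shows "(f' has_integral (f b - f a)) {a..b}"
proof -
  \<comment> \<open>On \<open>S\<close> nothing is known about \<open>f'\<close>. With the value 0
    there, only increments of \<open>f\<close> remain to be estimated; since \<open>S\<close> is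
    negligible, returning to \<open>f'\<close> at the end keeps the integral.\<close>
  define g where "g x = (if x \<in> S then 0 else f' x)" for x
  obtain \<sigma> :: "real \<Rightarrow> real" where \<sigma>: "mono \<sigma>" "\<And>u v. \<sigma> v - \<sigma> u \<le> 4"
    "\<And>u v n. \<lbrakk>u \<le> from_nat_into S n; from_nat_into S n \<le> v; u < v\<rbrakk> \<Longrightarrow> (1/2) ^ n \<le> \<sigma> v - \<sigma> u"
    using exists_jump_function[of "from_nat_into S"] by blast
  have "(g has_integral (f b - f a)) {a..b}"
    unfolding has_integral_real
  proof (intro allI impI)
    fix e :: real
    assume "e > 0"
    \<comment> \<open>The total error will be at most \<open>\<epsilon> * (b - a + 4)\<close>, where
      4 bounds the growth of \<open>\<sigma>\<close>; the 5 puts it strictly below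
      \<open>e\<close>.\<close>
    define \<epsilon> where "\<epsilon> = e / (b - a + 5)"
    have "\<epsilon> > 0" using \<open>e > 0\<close> \<open>a \<le> b\<close> by (simp add: \<epsilon>_def)
    define \<phi> where "\<phi> t = \<epsilon> * (t + \<sigma> t)" for t
    \<comment> \<open>A straddle estimate for short intervals around the tag \<open>x\<close>, with
      a bound that telescopes. The linear part of \<open>\<phi>\<close> pays at points of
      differentiability, the part with \<open>\<sigma>\<close> at points of
      \<open>S\<close>.\<close>
    have "\<exists>d>0. \<forall>u v. u \<in> {a..b} \<and> v \<in> {a..b} \<and> u \<le> x \<and> x \<le> v \<and> \<bar>u - x\<bar> < d \<and> \<bar>v - x\<bar> < d \<longrightarrow>
        norm ((v - u) *\<^sub>R g x - (f v - f u)) \<le> \<phi> v - \<phi> u" for x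
    proof (cases "x \<in> {a..b}")
      case False
      then show ?thesis by (intro exI[of _ 1]) auto
    next
      case x: True
      show ?thesis
      proof (cases "x \<in> S")
        case False
        then have "\<exists>d>0. \<forall>y\<in>{a..b}. norm (y - x) < d \<longrightarrow>
            norm (f y - f x - (y - x) *\<^sub>R f' x) \<le> \<epsilon> * norm (y - x)"
          using deriv[of x] x \<open>\<epsilon> > 0\<close>
          unfolding has_vector_derivative_def has_derivative_within_alt by blast
        then obtain d where "d > 0" and d: "\<And>y. y \<in> {a..b} \<Longrightarrow> norm (y - x) < d \<Longrightarrow>
            norm (f y - f x - (y - x) *\<^sub>R f' x) \<le> \<epsilon> * norm (y - x)" by blast
        show ?thesis
        proof (intro exI[of _ d] conjI allI impI)
          fix u v assume uv: "u \<in> {a..b} \<and> v \<in> {a..b} \<and> u \<le> x \<and> x \<le> v \<and> \<bar>u - x\<bar> < d \<and> \<bar>v - x\<bar> < d"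
          have "norm ((v - u) *\<^sub>R g x - (f v - f u)) =
              norm (f u - f x - (u - x) *\<^sub>R f' x - (f v - f x - (v - x) *\<^sub>R f' x))"
            using False by (auto simp: g_def algebra_simps)
          also have "\<dots> \<le> norm (f u - f x - (u - x) *\<^sub>R f' x) + norm (f v - f x - (v - x) *\<^sub>R f' x)"
            by (rule norm_triangle_ineq4)
          also have "\<dots> \<le> \<epsilon> * norm (u - x) + \<epsilon> * norm (v - x)"
            using uv by (intro add_mono d) auto
          also have "\<dots> = \<epsilon> * (v - u)"
            using uv by (simp add: algebra_simps)
          also have "\<dots> \<le> \<phi> v - \<phi> u"
            using monoD[OF \<sigma>(1), of u v] uv \<open>\<epsilon> > 0\<close> by (simp add: \<phi>_def algebra_simps)
          finally show "norm ((v - u) *\<^sub>R g x - (f v - f u)) \<le> \<phi> v - \<phi> u" .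
        qed (use \<open>d > 0\<close> in auto)
      next
        case True
        obtain n where n: "from_nat_into S n = x"
          using from_nat_into_surj[OF \<open>countable S\<close> True] by blast
        \<comment> \<open>Half of the growth of \<open>\<epsilon> * \<sigma>\<close> guaranteed
          across \<open>x\<close>: the moves of \<open>f\<close> from \<open>x\<close> to
          \<open>u\<close> and from \<open>x\<close> to \<open>v\<close> are charged one half
          each.\<close>
        define r where "r = \<epsilon> * (1/2) ^ n / 2"
        have "r > 0" using \<open>\<epsilon> > 0\<close> by (simp add: r_def)
        then obtain d where "d > 0" and d: "\<And>y. y \<in> {a..b} \<Longrightarrow> dist y x < d \<Longrightarrow> dist (f y) (f x) < r"
          using cont x unfolding continuous_on_iff by metis
        show ?thesis
        proof (intro exI[of _ d] conjI allI impI)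
          fix u v assume uv: "u \<in> {a..b} \<and> v \<in> {a..b} \<and> u \<le> x \<and> x \<le> v \<and> \<bar>u - x\<bar> < d \<and> \<bar>v - x\<bar> < d"
          show "norm ((v - u) *\<^sub>R g x - (f v - f u)) \<le> \<phi> v - \<phi> u"
          proof (cases "u < v")
            \<comment> \<open>A degenerate interval sees no jump of \<open>\<sigma>\<close>, but
              there both sides are 0.\<close>
            case False
            with uv have "u = v" by simp
            then show ?thesis by simp
          next
            case uv': True
            have "norm ((v - u) *\<^sub>R g x - (f v - f u)) = dist (f u) (f v)"
              using True by (simp add: g_def dist_norm)
            also have "\<dots> \<le> dist (f u) (f x) + dist (f v) (f x)"
              by (rule dist_triangle2)
            also have "\<dots> \<le> r + r"
              using uv by (intro add_mono less_imp_le d) (auto simp: dist_real_def)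
            also have "\<dots> \<le> \<epsilon> * (\<sigma> v - \<sigma> u)"
              using \<sigma>(3)[of u n v] uv uv' n \<open>\<epsilon> > 0\<close> by (simp add: r_def)
            also have "\<dots> \<le> \<phi> v - \<phi> u"
              using uv' \<open>\<epsilon> > 0\<close> by (simp add: \<phi>_def algebra_simps)
            finally show ?thesis .
          qed
        qed (use \<open>d > 0\<close> in auto)
      qed
    qed
    then obtain d where d: "\<And>x. d x > 0"
      "\<And>x u v. \<lbrakk>u \<in> {a..b}; v \<in> {a..b}; u \<le> x; x \<le> v; \<bar>u - x\<bar> < d x; \<bar>v - x\<bar> < d x\<rbrakk> \<Longrightarrow>
        norm ((v - u) *\<^sub>R g x - (f v - f u)) \<le> \<phi> v - \<phi> u"
      by metis
    show "\<exists>\<gamma>. gauge \<gamma> \<and> (\<forall>p. p tagged_division_of {a..b} \<and> \<gamma> fine p \<longrightarrow>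
        norm ((\<Sum>(x, K)\<in>p. measure lborel K *\<^sub>R g x) - (f b - f a)) < e)"
    proof (intro exI[of _ "\<lambda>x. ball x (d x)"] conjI allI impI)
      show "gauge (\<lambda>x. ball x (d x))"
        using d(1) gauge_ball_dependent by blast
    next
      fix p assume "p tagged_division_of {a..b} \<and> (\<lambda>x. ball x (d x)) fine p"
      then have ptag: "p tagged_division_of {a..b}" and fine: "(\<lambda>x. ball x (d x)) fine p"
        by auto
      \<comment> \<open>The increments of \<open>f\<close> over the division add up to
        \<open>f b - f a\<close>, so the error splits into one straddle error per tagged
        interval.\<close>
      have "norm ((\<Sum>(x, K)\<in>p. measure lborel K *\<^sub>R g x) - (f b - f a)) =
          norm (\<Sum>(x, K)\<in>p. measure lborel K *\<^sub>R g x - (f (Sup K) - f (Inf K)))"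
        using additive_tagged_division_1[OF \<open>a \<le> b\<close> ptag, of f]
        by (simp add: split_def sum_subtractf)
      also have "\<dots> \<le> (\<Sum>(x, K)\<in>p. \<phi> (Sup K) - \<phi> (Inf K))"
      proof (rule sum_norm_le, safe)
        fix x K assume xK: "(x, K) \<in> p"
        then have "x \<in> K" "K \<subseteq> {a..b}"
          using ptag by blast+
        then obtain u v where K: "K = cbox u v"
          using ptag xK by auto
        have "u \<le> v" "u \<in> K" "v \<in> K" using \<open>x \<in> K\<close> by (auto simp: K)
        moreover have "K \<subseteq> ball x (d x)"
          using fine xK by blast
        ultimately have "u \<in> ball x (d x)" "v \<in> ball x (d x)" by auto
        then show "norm (measure lborel K *\<^sub>R g x - (f (Sup K) - f (Inf K))) \<le> \<phi> (Sup K) - \<phi> (Inf K)"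
          using d(2)[of u v x] \<open>x \<in> K\<close> \<open>K \<subseteq> {a..b}\<close> \<open>u \<le> v\<close> \<open>u \<in> K\<close> \<open>v \<in> K\<close>
          by (auto simp: K dist_real_def)
      qed
      also have "\<dots> = \<phi> b - \<phi> a"
        by (rule additive_tagged_division_1[OF \<open>a \<le> b\<close> ptag])
      also have "\<dots> = \<epsilon> * (b - a + (\<sigma> b - \<sigma> a))"
        by (simp add: \<phi>_def algebra_simps)
      also have "\<dots> \<le> \<epsilon> * (b - a + 4)"
        using \<sigma>(2)[of b a] \<open>\<epsilon> > 0\<close> by simp
      also have "\<dots> < \<epsilon> * (b - a + 5)" using \<open>\<epsilon> > 0\<close> by simp
      also have "\<dots> = e" using \<open>a \<le> b\<close> by (simp add: \<epsilon>_def)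
      finally show "norm ((\<Sum>(x, K)\<in>p. measure lborel K *\<^sub>R g x) - (f b - f a)) < e" .
    qed
  qed
  moreover have "negligible S"
    using negligible_countable_Union[of "(\<lambda>x. {x}) ` S"] \<open>countable S\<close> by auto
  ultimately show ?thesis
    by (rule has_integral_spike[rotated 2]) (simp add: g_def)
qed

section \<open>Integrals over the half-line and Laplace transforms of linear equations\<close>

text \<open>Integrals over unbounded sets are limits over growing boxes. Cut down to
  \<open>{a..}\<close>, the box \<open>cbox c d\<close> becomes \<open>{max a c..d}\<close>, so once
  \<open>c \<le> a\<close> only the upper end still moves.\<close>

lemma has_integral_atLeast_iff:
  fixes f :: "real \<Rightarrow> 'a::banach"
  shows "(f has_integral L) {a..} \<longleftrightarrow>
    (\<forall>T. f integrable_on {a..T}) \<and> ((\<lambda>T. integral {a..T} f) \<longlongrightarrow> L) at_top"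
    (is "?l \<longleftrightarrow> ?r")
proof -
  have restrict: "{a..} \<inter> cbox c d = {max a c..d}" for c d by auto
  have alt: "(f has_integral L) {a..} \<longleftrightarrow>
      (\<forall>c d. f integrable_on {max a c..d}) \<and>
      (\<forall>e>0. \<exists>B>0. \<forall>c d. ball 0 B \<subseteq> cbox c d \<longrightarrow> norm (integral {max a c..d} f - L) < e)"
    unfolding has_integral_alt' integrable_restrict_Int integral_restrict_Int restrict ..
  show ?thesis
  proof
    assume l: ?l
    show ?r
    proof (intro conjI allI tendstoI)
      fix T
      show "f integrable_on {a..T}"
        using l alt by (metis max.idem)
    next
      fix e :: real assume "e > 0"
      then obtain B where B: "\<And>c d. ball 0 B \<subseteq> cbox c d \<Longrightarrow> norm (integral {max a c..d} f - L) < e"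
        using l alt by blast
      show "\<forall>\<^sub>F T in at_top. dist (integral {a..T} f) L < e"
        using eventually_ge_at_top[of "max B \<bar>a\<bar>"]
      proof eventually_elim
        case (elim T)
        have "ball 0 B \<subseteq> cbox (-T) T" using elim by (auto simp: dist_real_def)
        moreover have "max a (- T) = a" using elim by auto
        ultimately show ?case using B[of "- T" T] by (simp add: dist_norm)
      qed
    qed
  next
    assume r: ?r
    show ?l
      unfolding alt
    proof (intro conjI allI impI)
      fix c d
      show "f integrable_on {max a c..d}"
        by (rule integrable_on_subinterval[where S = "{a..d}"]) (use r in auto)
    next
      fix e :: real assume "e > 0"
      then obtain N where N: "\<And>T. T \<ge> N \<Longrightarrow> norm (integral {a..T} f - L) < e"
        using r unfolding tendsto_iff eventually_at_top_linorder dist_norm by blast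
      \<comment> \<open>The open ball of radius \<open>B\<close> contains \<open>B - 1\<close> and
        \<open>1 - B\<close>, so any box around it reaches down to \<open>a\<close> and up to
        \<open>N\<close>.\<close>
      define B where "B = \<bar>N\<bar> + \<bar>a\<bar> + 1"
      have "norm (integral {max a c..d} f - L) < e" if "ball 0 B \<subseteq> cbox c d" for c d
      proof -
        have "B - 1 \<in> cbox c d" "1 - B \<in> cbox c d"
          using that by (auto simp: B_def subset_iff dist_real_def)
        then have "max a c = a" "d \<ge> N" by (auto simp: B_def)
        then show ?thesis using N by simp
      qed
      moreover have "B > 0" by (simp add: B_def)
      ultimately show "\<exists>B>0. \<forall>c d. ball 0 B \<subseteq> cbox c d \<longrightarrow> norm (integral {max a c..d} f - L) < e"
        by blast
    qed
  qed
qed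

lemma has_vector_derivative_exp_times:
  fixes v :: "real \<Rightarrow> complex"
  assumes "(v has_vector_derivative v') (at t within A)"
  shows "((\<lambda>t. exp (c * of_real t) * v t) has_vector_derivative exp (c * of_real t) * (c * v t + v'))
    (at t within A)"
proof -
  have "((\<lambda>t. exp (c * of_real t)) has_vector_derivative c * exp (c * of_real t)) (at t within A)"
    by (rule has_vector_derivative_real_field) (auto intro!: derivative_eq_intros)
  from has_vector_derivative_mult[OF this assms] show ?thesis
    by (simp add: algebra_simps)
qed

text \<open>The integrating factor turns the equation into \<open>E' = exp (c t) g\<close>. Once
  \<open>g\<close> is smaller than \<open>e / 2 * \<rho>\<close>, this is dominated by the
  derivative of \<open>e / 2 * exp (\<rho> * t)\<close>. Dividing the factor out again leaves a
  decaying term plus \<open>e / 2\<close>.\<close>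

lemma tendsto_zero_forced_decay:
  fixes P g :: "real \<Rightarrow> complex"
  assumes c: "Re c > 0" and cont: "continuous_on {0..} P" and g: "(g \<longlongrightarrow> 0) at_top"
    and deriv: "\<And>t. t > 0 \<Longrightarrow> (P has_vector_derivative g t - c * P t) (at t)"
  shows "(P \<longlongrightarrow> 0) at_top"
proof (rule tendstoI)
  fix e :: real assume "e > 0"
  define \<rho> where "\<rho> = Re c"
  have "\<rho> > 0" using c by (simp add: \<rho>_def)
  define E where "E t = exp (c * of_real t) * P t" for t
  have E': "(E has_vector_derivative exp (c * of_real t) * g t) (at t)" if "t > 0" for t
    unfolding E_def using has_vector_derivative_exp_times[OF deriv[OF that], of c] by simp
  have normE: "norm (E t) = exp (\<rho> * t) * norm (P t)" for t
    by (simp add: E_def norm_mult \<rho>_def)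
  have "\<forall>\<^sub>F t in at_top. norm (g t) < e / 2 * \<rho>"
    using tendstoD[OF g, of "e / 2 * \<rho>"] \<open>e > 0\<close> \<open>\<rho> > 0\<close> by simp
  then obtain N where N: "\<And>t. t \<ge> N \<Longrightarrow> norm (g t) < e / 2 * \<rho>"
    by (auto simp: eventually_at_top_linorder)
  define t0 where "t0 = max N 0"
  have bound: "norm (P t) \<le> norm (E t0) * exp (- \<rho> * t) + e / 2" if "t > t0" for t
  proof -
    have "norm (E t - E t0) \<le> e / 2 * exp (\<rho> * t) - e / 2 * exp (\<rho> * t0)"
    proof (rule differentiable_bound_general[OF that])
      show "continuous_on {t0..t} E"
        unfolding E_def by (intro continuous_intros continuous_on_subset[OF cont]) (auto simp: t0_def)
      fix x assume x: "t0 < x" "x < t"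
      then show "(E has_vector_derivative exp (c * of_real x) * g x) (at x)"
        by (intro E') (auto simp: t0_def)
      show "((\<lambda>t. e / 2 * exp (\<rho> * t)) has_vector_derivative exp (\<rho> * x) * (e / 2 * \<rho>)) (at x)"
        unfolding has_real_derivative_iff_has_vector_derivative[symmetric]
        by (auto intro!: derivative_eq_intros)
      show "norm (exp (c * of_real x) * g x) \<le> exp (\<rho> * x) * (e / 2 * \<rho>)"
        using N[of x] x by (simp add: norm_mult \<rho>_def t0_def)
    qed (auto intro!: continuous_intros)
    also have "\<dots> \<le> e / 2 * exp (\<rho> * t)" using \<open>e > 0\<close> by simp
    finally have "norm (E t) \<le> norm (E t0) + e / 2 * exp (\<rho> * t)"
      using norm_triangle_sub[of "E t" "E t0"] by linarith
    then show ?thesis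
      unfolding normE[of t] by (simp add: exp_minus field_simps)
  qed
  have "((\<lambda>t. norm (E t0) * exp (- \<rho> * t) + e / 2) \<longlongrightarrow> norm (E t0) * 0 + e / 2) at_top"
  proof (intro tendsto_intros)
    have "filterlim (\<lambda>t. - \<rho> * t) at_bot at_top"
      using \<open>\<rho> > 0\<close> by (intro filterlim_tendsto_neg_mult_at_bot[OF tendsto_const]) (auto simp: filterlim_ident)
    then show "((\<lambda>t. exp (- \<rho> * t)) \<longlongrightarrow> 0) at_top"
      by (rule filterlim_compose[OF exp_at_bot])
  qed
  then have "\<forall>\<^sub>F t in at_top. norm (E t0) * exp (- \<rho> * t) + e / 2 < e"
    by (rule order_tendstoD(2)) (use \<open>e > 0\<close> in auto)
  then show "\<forall>\<^sub>F t in at_top. dist (P t) 0 < e"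
    using eventually_gt_at_top[of t0]
    by eventually_elim (use bound in \<open>force simp: dist_norm\<close>)
qed

text \<open>
  The Laplace integral \<open>M\<close> may converge only conditionally, so \<open>v\<close> has no a priori growth bound.
  Instead, \<open>Q T = \<integral>\<^sub>0\<^sup>T exp (-st) v(t) dt\<close> itself solves a stable
  linear equation with convergent forcing.
\<close>

lemma has_laplace_first_order:
  fixes v m :: "real \<Rightarrow> complex"
  assumes cont: "continuous_on {0..} v" and S: "countable S"
    and deriv: "\<And>t. t \<in> {0..} - S \<Longrightarrow> (v has_vector_derivative \<mu> * v t + m t) (at t within {0..})"
    and m: "has_laplace m M s" and s: "Re s > Re \<mu>"
  shows "has_laplace v ((M + v 0) / (s - \<mu>)) s"
proof -
  define c where "c = s - \<mu>"
  have c: "Re c > 0" "c \<noteq> 0" using s by (auto simp: c_def)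
  define V where "V t = exp (- s * of_real t) * v t" for t
  define I where "I T = integral {0..T} (\<lambda>t. exp (- s * of_real t) * m t)" for T
  define Q where "Q T = integral {0..T} V" for T
  have int_m: "(\<lambda>t. exp (- s * of_real t) * m t) integrable_on {0..T}"
    and lim_m: "(I \<longlongrightarrow> M) at_top" for T
    using m unfolding has_laplace_def has_integral_atLeast_iff I_def by auto
  have contV: "continuous_on {0..} V"
    unfolding V_def by (intro continuous_intros cont)
  have intV: "V integrable_on {0..T}" for T
    by (intro integrable_continuous_real continuous_on_subset[OF contV]) auto
  \<comment> \<open>Integrating \<open>V' = exp (- s t) m - c V\<close>, which holds off
    \<open>S\<close>, gives the equation \<open>Q' = v 0 + I - c Q\<close>.\<close>
  have V_eq: "V T = v 0 + I T - c * Q T" if "T \<ge> 0" for T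
  proof -
    have "((\<lambda>t. exp (- s * of_real t) * m t - c * V t) has_integral V T - V 0) {0..T}"
    proof (rule fundamental_theorem_of_calculus_countable[OF that S])
      show "continuous_on {0..T} V"
        by (rule continuous_on_subset[OF contV]) auto
      fix t assume "t \<in> {0..T} - S"
      then have "(v has_vector_derivative \<mu> * v t + m t) (at t within {0..T})"
        by (intro has_vector_derivative_within_subset[OF deriv]) auto
      from has_vector_derivative_exp_times[OF this, of "- s"]
      show "(V has_vector_derivative exp (- s * of_real t) * m t - c * V t) (at t within {0..T})"
        by (simp add: V_def[abs_def] c_def algebra_simps)
    qed
    moreover have "((\<lambda>t. exp (- s * of_real t) * m t - c * V t) has_integral I T - c * Q T) {0..T}"
      unfolding I_def Q_def
      by (intro has_integral_diff has_integral_mult_right integrable_integral int_m intV)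
    ultimately have "V T - V 0 = I T - c * Q T"
      by (rule has_integral_unique)
    then show ?thesis by (simp add: V_def algebra_simps)
  qed
  \<comment> \<open>\<open>(M + v 0) / c\<close> is the equilibrium of the equation for
    \<open>Q\<close> when \<open>I\<close> is replaced by its limit \<open>M\<close>;
    \<open>P\<close> is the deviation from it.\<close>
  define P where "P T = Q T - (M + v 0) / c" for T
  have "(P \<longlongrightarrow> 0) at_top"
  proof (rule tendsto_zero_forced_decay[OF c(1)])
    show "((\<lambda>T. I T - M) \<longlongrightarrow> 0) at_top"
      using lim_m by (rule LIM_zero)
    have Q': "(Q has_vector_derivative V t) (at t within {0..T})" if "t \<in> {0..T}" for t T
      unfolding Q_def
      by (intro integral_has_vector_derivative continuous_on_subset[OF contV] that) auto
    have "continuous (at t within {0..}) Q" if "t \<ge> 0" for t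
    proof -
      \<comment> \<open>Ending the interval beyond \<open>t\<close> makes it coincide with the
        half-line near \<open>t\<close>.\<close>
      have "continuous (at t within {0..t + 1}) Q"
        using Q'[of t "t + 1"] that by (intro has_vector_derivative_continuous) auto
      moreover have "at t within {0..t + 1} = at t within {0..}"
        by (rule at_within_nhd[of _ "{..<t + 1}"]) auto
      ultimately show ?thesis by simp
    qed
    then show "continuous_on {0..} P"
      unfolding P_def by (intro continuous_intros) (auto simp: continuous_on_eq_continuous_within)
    fix t :: real assume "t > 0"
    have "(Q has_vector_derivative V t) (at t)"
      using Q'[of t "t + 1"] \<open>t > 0\<close> by (simp add: at_within_Icc_at)
    then have "(P has_vector_derivative V t - 0) (at t)"
      unfolding P_def by (intro derivative_intros)
    moreover have "c * P t = c * Q t - (M + v 0)"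
      using c by (simp add: P_def right_diff_distrib)
    then have "V t - 0 = I t - M - c * P t"
      using V_eq[of t] \<open>t > 0\<close> by simp
    ultimately show "(P has_vector_derivative I t - M - c * P t) (at t)" by simp
  qed
  then have "(Q \<longlongrightarrow> (M + v 0) / c) at_top"
    unfolding P_def by (rule LIM_zero_cancel)
  with intV show ?thesis
    unfolding has_laplace_def has_integral_atLeast_iff c_def Q_def V_def by auto
qed

text \<open>The first-order result is applied to \<open>v\<close> with rate \<open>\<mu>\<close>,
  then to \<open>x\<close> with rate \<open>\<nu>\<close> and input \<open>v\<close>; the output is
  recovered as \<open>y = v + \<nu> x\<close>. No partial fractions occur, so a double root is no
  special case.\<close>

lemma has_laplace_second_order:
  fixes x y m :: "real \<Rightarrow> complex"
  assumes cont: "continuous_on {0..} y" and S: "countable S"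
    and y: "\<And>t. t \<in> {0..} - S \<Longrightarrow>
      (y has_vector_derivative m t - x t + (\<nu> + \<mu>) * y t) (at t within {0..})"
    and x: "\<And>t. t \<ge> 0 \<Longrightarrow> (x has_vector_derivative y t) (at t within {0..})"
    and roots: "\<nu> * \<mu> = 1" and init: "x 0 = 0" "y 0 = 0"
    and m: "has_laplace m M s" and s: "Re s > Re \<nu>" "Re s > Re \<mu>"
  shows "has_laplace y (s / ((s - \<nu>) * (s - \<mu>)) * M) s"
proof -
  define v where "v t = y t - \<nu> * x t" for t
  have contx: "continuous_on {0..} x"
    using x has_vector_derivative_continuous by (fastforce simp: continuous_on_eq_continuous_within)
  have contv: "continuous_on {0..} v"
    unfolding v_def by (intro continuous_intros cont contx)
  have v: "has_laplace v ((M + v 0) / (s - \<mu>)) s"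
  proof (rule has_laplace_first_order[OF contv S _ m s(2)])
    fix t assume t: "t \<in> {0..} - S"
    have "(v has_vector_derivative (m t - x t + (\<nu> + \<mu>) * y t) - \<nu> * y t) (at t within {0..})"
      unfolding v_def
      by (intro has_vector_derivative_diff has_vector_derivative_mult_right y x) (use t in auto)
    \<comment> \<open>Substituting \<open>y = v + \<nu> x\<close> leaves the multiple
      \<open>(\<nu> * \<mu> - 1) * x\<close>, which vanishes by \<open>roots\<close>.\<close>
    also have "(m t - x t + (\<nu> + \<mu>) * y t) - \<nu> * y t = \<mu> * v t + m t"
      using roots by (simp add: v_def algebra_simps)
    finally show "(v has_vector_derivative \<mu> * v t + m t) (at t within {0..})" .
  qed
  have "has_laplace x (((M + v 0) / (s - \<mu>) + x 0) / (s - \<nu>)) s"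
    by (rule has_laplace_first_order[OF contx _ _ v s(1), of "{}"]) (use x in \<open>auto simp: v_def\<close>)
  then have x': "has_laplace x (M / (s - \<mu>) / (s - \<nu>)) s"
    by (simp add: init v_def)
  have "((\<lambda>t. exp (- s * of_real t) * v t + \<nu> * (exp (- s * of_real t) * x t))
      has_integral M / (s - \<mu>) + \<nu> * (M / (s - \<mu>) / (s - \<nu>))) {0..}"
    using v x' unfolding has_laplace_def
    by (intro has_integral_add has_integral_mult_right) (simp_all add: v_def init)
  moreover have "M / (s - \<mu>) + \<nu> * (M / (s - \<mu>) / (s - \<nu>)) = s / ((s - \<nu>) * (s - \<mu>)) * M"
  proof -
    have "s - \<mu> \<noteq> 0" "s - \<nu> \<noteq> 0" using s by auto
    then show ?thesis by (simp add: divide_simps) (simp add: algebra_simps)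
  qed
  ultimately show ?thesis
    unfolding has_laplace_def by (simp add: v_def algebra_simps)
qed

section \<open>A transfer function of the discriminator and a test input\<close>

text \<open>The result of eliminating the transform \<open>G\<close> of the generator from
  \<open>s D = M - G - \<tau> D\<close> and \<open>s G = D\<close>.\<close>

definition discriminator_transfer :: "real \<Rightarrow> complex \<Rightarrow> complex" where
  "discriminator_transfer \<tau> s = s / (s\<^sup>2 + of_real \<tau> * s + 1)"

text \<open>Each component is a scalar second-order problem whose rates are the two complex roots of
  the denominator. The transform formula holds to the right of both roots and of the half-plane
  boundary \<open>a\<close> of the input.\<close>

lemma transfer_function_discriminator:
  "transfer_function
    (discriminator_system \<tau> :: (real \<Rightarrow> real ^ 'n) \<Rightarrow> (real \<Rightarrow> real ^ 'n) \<Rightarrow> bool)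
    (discriminator_transfer \<tau>)"
proof -
  define \<nu> where "\<nu> = (- of_real \<tau> + csqrt (of_real \<tau> ^ 2 - 4)) / 2"
  define \<mu> where "\<mu> = (- of_real \<tau> - csqrt (of_real \<tau> ^ 2 - 4)) / 2"
  have sum: "\<nu> + \<mu> = - of_real \<tau>"
    by (simp add: \<nu>_def \<mu>_def field_simps)
  have "\<nu> * \<mu> = (of_real \<tau> ^ 2 - csqrt (of_real \<tau> ^ 2 - 4) ^ 2) / 4"
    unfolding \<nu>_def \<mu>_def by (simp add: field_simps power2_eq_square)
  then have prod: "\<nu> * \<mu> = 1" by simp
  have factor: "(s - \<nu>) * (s - \<mu>) = s\<^sup>2 + of_real \<tau> * s + 1" for s
  proof -
    have "(s - \<nu>) * (s - \<mu>) = s\<^sup>2 - (\<nu> + \<mu>) * s + \<nu> * \<mu>"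
      by (simp add: algebra_simps power2_eq_square)
    then show ?thesis by (simp add: sum prod)
  qed
  have "rational_function (discriminator_transfer \<tau>)"
    unfolding rational_function_def
    by (intro exI[of _ "[:0, 1:]"] exI[of _ "[:1, of_real \<tau>, 1:]"])
      (auto simp: discriminator_transfer_def fun_eq_iff power2_eq_square algebra_simps)
  moreover have "laplace_transform y (\<lambda>s. discriminator_transfer \<tau> s *s U s)"
    if sys: "discriminator_system \<tau> u y" and U: "laplace_transform u U"
    for u y :: "real \<Rightarrow> real ^ 'n" and U :: "complex \<Rightarrow> complex ^ 'n"
  proof -
    obtain x S where y: "continuous_on {0..} y" "y 0 = 0"
      and S: "countable S"
      and y': "\<And>t. t \<in> {0..} - S \<Longrightarrow>
        (y has_vector_derivative (u t - x t - \<tau> *\<^sub>R y t)) (at t within {0..})"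
      and x: "\<And>t. t \<in> {0..} \<Longrightarrow> (x has_vector_derivative y t) (at t within {0..})" "x 0 = 0"
      using sys unfolding discriminator_system_def closed_loop_solution_def by blast
    obtain a where a: "\<And>s. Re s > a \<Longrightarrow> has_laplace_vec u (U s) s"
      using U unfolding laplace_transform_def by blast
    have lin: "bounded_linear (\<lambda>w :: real ^ 'n. complex_of_real (w $ i))" for i
      using bounded_linear_compose[OF bounded_linear_of_real bounded_linear_vec_nth] .
    have "has_laplace (\<lambda>t. of_real (y t $ i)) (discriminator_transfer \<tau> s * U s $ i) s"
      if s: "Re s > max a (max (Re \<nu>) (Re \<mu>))" for s i
      unfolding discriminator_transfer_def factor[symmetric]
    proof (rule has_laplace_second_order[OF _ S])
      show "continuous_on {0..} (\<lambda>t. complex_of_real (y t $ i))"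
        by (intro continuous_intros y)
      show "has_laplace (\<lambda>t. of_real (u t $ i)) (U s $ i) s"
        using a[of s] s unfolding has_laplace_vec_def by simp
    next
      fix t assume "t \<in> {0..} - S"
      from bounded_linear.has_vector_derivative[OF lin y'[OF this], of i]
      show "((\<lambda>t. complex_of_real (y t $ i)) has_vector_derivative
          of_real (u t $ i) - of_real (x t $ i) + (\<nu> + \<mu>) * of_real (y t $ i)) (at t within {0..})"
        by (simp add: sum)
    next
      fix t :: real assume "t \<ge> 0"
      then show "((\<lambda>t. complex_of_real (x t $ i)) has_vector_derivative of_real (y t $ i)) (at t within {0..})"
        by (intro bounded_linear.has_vector_derivative[OF lin x(1)]) auto
    qed (use s prod x y in auto)
    then show ?thesis
      unfolding laplace_transform_def has_laplace_vec_def
      by (intro exI[of _ "max a (max (Re \<nu>) (Re \<mu>))"]) (simp add: vector_smult_component)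
  qed
  ultimately show ?thesis unfolding transfer_function_def by blast
qed

text \<open>The test solution is \<open>\<theta>G(t) = t\<^sup>2 / 2\<close>, \<open>\<theta>D(t) = t\<close>.\<close>

lemma discriminator_system_test:
  obtains u y :: "real \<Rightarrow> real ^ 'n" and U :: "complex \<Rightarrow> complex ^ 'n" where
    "discriminator_system \<tau> u y" "laplace_transform u U"
    "\<And>s i. Re s > 0 \<Longrightarrow> U s $ i = (s\<^sup>2 + of_real \<tau> * s + 1) / s ^ 3"
proof -
  \<comment> \<open>The input is read off from the solution as
    \<open>u = x'' + \<tau> x' + x\<close>, so the numerator of its transform is the characteristic
    polynomial.\<close>
  define u :: "real \<Rightarrow> real ^ 'n" where "u t = (\<chi> i. 1 + \<tau> * t + t\<^sup>2 / 2)" for t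
  define y :: "real \<Rightarrow> real ^ 'n" where "y t = (\<chi> i. t)" for t
  define x :: "real \<Rightarrow> real ^ 'n" where "x t = (\<chi> i. t\<^sup>2 / 2)" for t
  define U :: "complex \<Rightarrow> complex ^ 'n"
    where "U s = (\<chi> i. (s\<^sup>2 + of_real \<tau> * s + 1) / s ^ 3)" for s
  show ?thesis
  proof (rule that)
    have y_eq: "y = (\<lambda>t. t *\<^sub>R (\<chi> i. 1))" by (auto simp: y_def vec_eq_iff)
    have x_eq: "x = (\<lambda>t. (t\<^sup>2 / 2) *\<^sub>R (\<chi> i. 1))" by (auto simp: x_def vec_eq_iff)
    have "(y has_vector_derivative (u t - x t - \<tau> *\<^sub>R y t)) (at t within {0..})" for t
      unfolding y_eq
      by (auto intro!: derivative_eq_intros simp: u_def x_def vec_eq_iff)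
    moreover have "(x has_vector_derivative y t) (at t within {0..})" for t
      unfolding x_eq y_eq
      by (auto intro!: derivative_eq_intros)
    moreover have "continuous_on {0..} y"
      unfolding y_eq by (intro continuous_intros)
    moreover have "x 0 = 0" "y 0 = 0" by (auto simp: x_def y_def vec_eq_iff)
    ultimately show "discriminator_system \<tau> u y"
      unfolding discriminator_system_def closed_loop_solution_def
      by (intro exI[of _ x] conjI exI[of _ "{}"]) auto
  next
    have "has_laplace (\<lambda>t. of_real (1 + \<tau> * t + t\<^sup>2 / 2)) ((s\<^sup>2 + of_real \<tau> * s + 1) / s ^ 3) s"
      if s: "Re s > 0" for s
    proof -
      have s0: "s \<noteq> 0" using s by auto
      \<comment> \<open>With \<open>\<mu> = 0\<close> the first-order result is the integration
        rule. It climbs from 0 to 1, \<open>t\<close> and \<open>t\<^sup>2 / 2\<close>, each with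
        the preceding function as derivative.\<close>
      have "has_laplace (\<lambda>t. 0) 0 s" by (simp add: has_laplace_def)
      from has_laplace_first_order[where v = "\<lambda>t. 1" and \<mu> = 0 and S = "{}", OF _ _ _ this] s
      have 1: "has_laplace (\<lambda>t. 1) (1 / s) s" by simp
      have "has_laplace (\<lambda>t. of_real t) ((1 / s + of_real 0) / (s - 0)) s"
        by (rule has_laplace_first_order[where S = "{}", OF _ _ _ 1])
          (use s in \<open>auto intro!: continuous_intros derivative_eq_intros\<close>)
      then have 2: "has_laplace (\<lambda>t. of_real t) (1 / s\<^sup>2) s"
        by (simp add: power2_eq_square)
      have "has_laplace (\<lambda>t. of_real (t\<^sup>2 / 2)) ((1 / s\<^sup>2 + of_real (0\<^sup>2 / 2)) / (s - 0)) s"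
      proof (rule has_laplace_first_order[where S = "{}", OF _ _ _ 2])
        fix t :: real
        have "((\<lambda>t::real. t\<^sup>2 / 2) has_real_derivative t) (at t within {0..})"
          by (auto intro!: derivative_eq_intros)
        from has_vector_derivative_of_real[OF this]
        show "((\<lambda>t. complex_of_real (t\<^sup>2 / 2)) has_vector_derivative 0 * of_real (t\<^sup>2 / 2) + of_real t)
            (at t within {0..})" by (simp only: mult_zero_left add_0_left)
      qed (use s in \<open>auto intro!: continuous_intros\<close>)
      then have 3: "has_laplace (\<lambda>t. of_real (t\<^sup>2 / 2)) (1 / s ^ 3) s"
        by (simp add: power3_eq_cube power2_eq_square)
      have "((\<lambda>t. exp (- s * of_real t) * 1 + of_real \<tau> * (exp (- s * of_real t) * of_real t) +
          exp (- s * of_real t) * of_real (t\<^sup>2 / 2))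
          has_integral 1 / s + of_real \<tau> * (1 / s\<^sup>2) + 1 / s ^ 3) {0..}"
        using 1 2 3 unfolding has_laplace_def
        by (intro has_integral_add has_integral_mult_right)
      moreover have "1 / s + of_real \<tau> * (1 / s\<^sup>2) + 1 / s ^ 3 = (s\<^sup>2 + of_real \<tau> * s + 1) / s ^ 3"
        using s0 by (simp add: field_simps power2_eq_square power3_eq_cube)
      ultimately show ?thesis
        unfolding has_laplace_def by (simp add: algebra_simps)
    qed
    then show "laplace_transform u U"
      unfolding laplace_transform_def has_laplace_vec_def u_def U_def
      by (intro exI[of _ 0]) simp
  qed (simp add: U_def)
qed

section \<open>Location of the roots and uniqueness on a right half-plane\<close>

text \<open>The imaginary part of the equation forces \<open>z\<close> to be real or
  \<open>Re z = - \<tau> / 2\<close>. For real \<open>z\<close> the equation reads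
  \<open>\<tau> z = - (z\<^sup>2 + 1)\<close>.\<close>

lemma characteristic_polynomial_root_Re_neg:
  fixes \<tau> :: real
  assumes "\<tau> > 0" and root: "z\<^sup>2 + of_real \<tau> * z + 1 = 0"
  shows "Re z < 0"
proof -
  have re: "(Re z)\<^sup>2 - (Im z)\<^sup>2 + \<tau> * Re z + 1 = 0"
    using arg_cong[OF root, of Re] by (simp add: power2_eq_square)
  have "Im z * (2 * Re z + \<tau>) = 0"
    using arg_cong[OF root, of Im] by (simp add: power2_eq_square algebra_simps)
  then consider "Im z = 0" | "2 * Re z + \<tau> = 0" by auto
  then show ?thesis
  proof cases
    case 1
    then have "\<tau> * Re z = - ((Re z)\<^sup>2 + 1)" using re by simp
    also have "\<dots> < 0" using zero_le_power2[of "Re z"] by linarith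
    finally show ?thesis using \<open>\<tau> > 0\<close> by (simp add: mult_less_0_iff)
  next
    case 2
    then show ?thesis using \<open>\<tau> > 0\<close> by linarith
  qed
qed

text \<open>On the test input both functions give the transform of the same output, which is unique.
  The transform of the input can be cancelled, as its numerator has no zeros with positive real
  part.\<close>

lemma transfer_function_eq_discriminator_transfer:
  assumes "\<tau> > 0"
    and T: "transfer_function
      (discriminator_system \<tau> :: (real \<Rightarrow> real ^ 'n) \<Rightarrow> (real \<Rightarrow> real ^ 'n) \<Rightarrow> bool) T"
  obtains b where "b \<ge> 0" "\<And>s. Re s > b \<Longrightarrow> T s = discriminator_transfer \<tau> s"
proof -
  obtain u y :: "real \<Rightarrow> real ^ 'n" and U :: "complex \<Rightarrow> complex ^ 'n"
    where sys: "discriminator_system \<tau> u y" "laplace_transform u U"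
    and U: "\<And>s i. Re s > 0 \<Longrightarrow> U s $ i = (s\<^sup>2 + of_real \<tau> * s + 1) / s ^ 3"
    using discriminator_system_test by blast
  have "laplace_transform y (\<lambda>s. T s *s U s)"
    using T sys unfolding transfer_function_def by blast
  then obtain b1 where b1: "\<And>s. Re s > b1 \<Longrightarrow> has_laplace_vec y (T s *s U s) s"
    unfolding laplace_transform_def by blast
  have "laplace_transform y (\<lambda>s. discriminator_transfer \<tau> s *s U s)"
    using transfer_function_discriminator sys unfolding transfer_function_def by blast
  then obtain b2 where b2: "\<And>s. Re s > b2 \<Longrightarrow> has_laplace_vec y (discriminator_transfer \<tau> s *s U s) s"
    unfolding laplace_transform_def by blast
  show ?thesis
  proof
    fix s assume s: "Re s > max 0 (max b1 b2)"
    fix i :: 'n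
    have "T s * U s $ i = discriminator_transfer \<tau> s * U s $ i"
      using b1[of s] b2[of s] s unfolding has_laplace_vec_def has_laplace_def vector_smult_component
      by (intro has_integral_unique) auto
    moreover have "s\<^sup>2 + of_real \<tau> * s + 1 \<noteq> 0"
      using characteristic_polynomial_root_Re_neg[OF \<open>\<tau> > 0\<close>, of s] s by auto
    moreover have "s \<noteq> 0" using s by auto
    ultimately show "T s = discriminator_transfer \<tau> s"
      using U[of s i] s by simp
  qed simp
qed

section \<open>Poles of an arbitrary transfer function\<close>

theorem theorem4:
  fixes \<tau> :: real
  assumes "\<tau> > 0"
  shows "stable_system
    (discriminator_system \<tau> :: (real \<Rightarrow> real ^ 'n) \<Rightarrow> (real \<Rightarrow> real ^ 'n) \<Rightarrow> bool)"
  unfolding stable_system_def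
proof (intro conjI allI impI)
  show "\<exists>T. transfer_function
      (discriminator_system \<tau> :: (real \<Rightarrow> real ^ 'n) \<Rightarrow> (real \<Rightarrow> real ^ 'n) \<Rightarrow> bool) T"
    using transfer_function_discriminator by blast
next
  fix T z
  assume T: "transfer_function
      (discriminator_system \<tau> :: (real \<Rightarrow> real ^ 'n) \<Rightarrow> (real \<Rightarrow> real ^ 'n) \<Rightarrow> bool) T"
    and pole: "is_pole T z"
  obtain b where "b \<ge> 0" and b: "\<And>s. Re s > b \<Longrightarrow> T s = discriminator_transfer \<tau> s"
    using transfer_function_eq_discriminator_transfer[OF assms T] by blast
  obtain p q where "q \<noteq> 0" and T_eq: "T = (\<lambda>s. poly p s / poly q s)"
    using T unfolding transfer_function_def rational_function_def by blast
  define D where "D = [:1, of_real \<tau>, 1 :: complex:]"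
  have D: "poly D s = s\<^sup>2 + of_real \<tau> * s + 1" for s
    by (simp add: D_def power2_eq_square algebra_simps)
  have "poly (p * D - [:0, 1:] * q) s = 0" if s: "Re s > b" for s
  proof -
    have "poly D s \<noteq> 0" "s \<noteq> 0"
      using characteristic_polynomial_root_Re_neg[OF assms, of s] s \<open>b \<ge> 0\<close> by (auto simp: D)
    moreover from this have "poly p s / poly q s = s / poly D s"
      using b[OF s] by (simp add: T_eq discriminator_transfer_def D)
    \<comment> \<open>A zero of \<open>q\<close> is impossible here: the quotient would take the
      default value 0, whereas \<open>s / poly D s\<close> is nonzero.\<close>
    ultimately show ?thesis
      by (cases "poly q s = 0") (auto simp: field_simps)
  qed
  then have "{s. Re s > b} \<subseteq> {s. poly (p * D - [:0, 1:] * q) s = 0}" by blast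
  moreover have "infinite {s. Re s > b}"
  proof
    assume "finite {s. Re s > b}"
    then have "finite (Re ` {s. Re s > b})" by simp
    moreover have "{b<..} \<subseteq> Re ` {s. Re s > b}"
      by (auto intro!: image_eqI[of _ Re "of_real _"])
    ultimately show False using infinite_Ioi finite_subset by blast
  qed
  \<comment> \<open>A polynomial vanishing on a half-plane is zero, which carries the identity over
    to the whole plane.\<close>
  ultimately have *: "p * D - [:0, 1:] * q = 0"
    using poly_roots_finite finite_subset by blast
  have pq: "poly p s * poly D s = s * poly q s" for s
    using arg_cong[OF *, of "\<lambda>r. poly r s"]
    by (simp only: poly_diff poly_mult poly_pCons poly_0) simp
  show "Re z < 0"
  proof (rule ccontr)
    assume "\<not> Re z < 0"
    then have Dz: "poly D z \<noteq> 0"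
      using characteristic_polynomial_root_Re_neg[OF assms, of z] by (auto simp: D)
    \<comment> \<open>\<open>q\<close> may vanish at \<open>z\<close> itself, but its zeros are
      isolated. On a punctured neighbourhood \<open>T\<close> is therefore
      \<open>s / poly D s\<close>, whose limit at \<open>z\<close> is finite, contradicting the
      pole.\<close>
    have "\<forall>\<^sub>F s in at z. poly q s \<noteq> 0"
      using islimpt_finite[OF poly_roots_finite[OF \<open>q \<noteq> 0\<close>], of z]
      by (simp add: islimpt_iff_eventually)
    moreover have "\<forall>\<^sub>F s in at z. poly D s \<noteq> 0"
      by (rule tendsto_imp_eventually_ne[OF _ Dz]) (intro tendsto_intros)
    ultimately have "\<forall>\<^sub>F s in at z. T s = s / poly D s"
      by eventually_elim (use pq in \<open>simp add: T_eq field_simps\<close>)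
    moreover have "((\<lambda>s. s / poly D s) \<longlongrightarrow> z / poly D z) (at z)"
      by (intro tendsto_intros Dz)
    ultimately have "(T \<longlongrightarrow> z / poly D z) (at z)"
      by (simp add: tendsto_cong)
    then show False
      using pole not_tendsto_and_filterlim_at_infinity[OF at_neq_bot] unfolding is_pole_def by blast
  qed
qed

end
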